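(* Let $R_3(n)$ be the number of partitions of $n$ with max-rook number $3$. For every integer $n>9$, written as $n=3m+a$ with $m$ an integer and $0\le a\le 2$, we have $$R_3(n)=\begin{cases} 6m^2-15m+7, & \text{if } a=0,\\ 6m^2-11m+2, & \text{if } a=1,\\ 6m^2-7m-1, & \text{if } a=2.\end{cases}$$ Further, for any fixed integer $p\ge 2$, $R_3(n) \bmod p$ is periodic in $n$ for $n>9$ with period $3p$, i.e. for all $n>9$, $$R_3(n+3p)\equiv R_3(n) \pmod p.$$
   Context: A partition $\pi$ of a positive integer $n$ is a non-increasing sequence of positive integers $(\lambda_1,\dots,\lambda_r)$ with sum $n$; $\mathscr{P}(n)$ is the set of all partitions of $n$. The Ferrers board $B_\pi$ of $\pi=(\lambda_1,\dots,\lambda_r)$ is the left-justified array of unit squares with $r$ rows whose $i$-th row from the top has $\lambda_i$ squares. Rooks placed on squares of the board are non-intersecting if no two of them lie in the same row or the same column. The max-rook number $R(\pi)$ is the maximal number of non-intersecting rooks that can be placed in $B_\pi$. For positive integers $n,k$, $R_k(n):=\#\{\pi\in\mathscr{P}(n) : R(\pi)=k\}$. "Periodic with period $3p$" means exactly the displayed congruence (minimality of the period is not asserted). *)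

theory Defs
  imports "HOL-Number_Theory.Cong"
begin

definition int_partitions :: "nat \<Rightarrow> nat list set" where
  "int_partitions n = {\<pi>. sorted_wrt (\<ge>) \<pi> \<and> (\<forall>x \<in> set \<pi>. 0 < x) \<and> sum_list \<pi> = n}"

text \<open>Rows and columns are numbered from 0, so \<open>(i, j)\<close> is the square in row \<open>i + 1\<close> from the top
  and column \<open>j + 1\<close> from the left.\<close>

definition ferrers_board :: "nat list \<Rightarrow> (nat \<times> nat) set" where
  "ferrers_board \<pi> = {(i, j). i < length \<pi> \<and> j < \<pi> ! i}"

definition non_intersecting :: "(nat \<times> nat) set \<Rightarrow> bool" where
  "non_intersecting S \<longleftrightarrow> (\<forall>s \<in> S. \<forall>t \<in> S. s \<noteq> t \<longrightarrow> fst s \<noteq> fst t \<and> snd s \<noteq> snd t)"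

definition rook_placements :: "nat list \<Rightarrow> (nat \<times> nat) set set" where
  "rook_placements \<pi> = {S. S \<subseteq> ferrers_board \<pi> \<and> non_intersecting S}"

definition max_rook :: "nat list \<Rightarrow> nat" where
  "max_rook \<pi> = Max (card ` rook_placements \<pi>)"

definition R :: "nat \<Rightarrow> nat \<Rightarrow> nat" where
  "R k n = card {\<pi> \<in> int_partitions n. max_rook \<pi> = k}"

text \<open>The next three facts ensure that \<open>Max\<close> and \<open>card\<close> above do not take their junk values.\<close>

lemma finite_rook_placements: "finite (rook_placements \<pi>)"
proof -
  have "ferrers_board \<pi> = (SIGMA i:{..<length \<pi>}. {..<\<pi> ! i})"
    by (auto simp: ferrers_board_def)
  then have "finite (ferrers_board \<pi>)"
    by simp
  then show ?thesis
    by (auto simp: rook_placements_def intro: finite_subset[of _ "Pow (ferrers_board \<pi>)"])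
qed

lemma rook_placements_nonempty: "rook_placements \<pi> \<noteq> {}"
  by (auto simp: rook_placements_def non_intersecting_def intro: exI[of _ "{}"])

lemma finite_int_partitions: "finite (int_partitions n)"
proof -
  have len: "length xs \<le> sum_list xs" if "\<forall>x \<in> set xs. 0 < x" for xs :: "nat list"
    using that by (induction xs) auto
  have "int_partitions n \<subseteq> {xs. set xs \<subseteq> {..n} \<and> length xs \<le> n}"
    by (auto simp: int_partitions_def len member_le_sum_list)
  then show ?thesis
    by (rule finite_subset) (intro finite_lists_length_le finite_atMost)
qed

end

theory Submission
  imports Defs
begin

text \<open>
  By the staircase criterion \<open>max_rook_ge_iff\<close>, the board of \<open>\<pi>\<close> carries \<open>k\<close> non-intersecting rooks if
  and only if it contains the staircase with rows of length \<open>k, k - 1, \<dots>, 1\<close>. Hence the max-rook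
  number is \<open>3\<close> exactly when \<open>(3, 2, 1)\<close> fits into \<open>\<pi> = (x, y, z, \<dots>)\<close> but \<open>(4, 3, 2, 1)\<close> does not:
  \<open>x \<ge> 3\<close>, \<open>y \<ge> 2\<close>, there is a third part \<open>z\<close>, and \<open>x = 3\<close> or \<open>y = 2\<close> or \<open>z = 1\<close> or there is
  no fourth part. Sorting by the first of these alternatives that holds gives four disjoint
  families, each described by two free parameters. For \<open>n > 9\<close> the parameters range over all lattice
  points of a triangle \<open>p a + q b \<le> N\<close> except one; this is \<open>R_3_eq_card_triangles\<close>:
  \<open>R\<^sub>3(n) + 4 = T(n - 3) + T(n - 6) + P(n - 6) + P(n - 7)\<close>, where \<open>T(N)\<close> counts the pairs with
  \<open>3 a + 2 b \<le> N\<close> and \<open>P(N)\<close> those with \<open>2 a + b \<le> N\<close>.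

  Each of \<open>T\<close> and \<open>P\<close> alone depends on the parity of its argument, but the two combinations
  that occur do not: \<open>P(N + 1) + P(N)\<close> is the triangular number \<open>(N + 2)(N + 3)/2\<close>, and
  \<open>T(N + 3) + T(N)\<close> grows by \<open>N + 6\<close> when \<open>N\<close> grows by \<open>3\<close>. Therefore \<open>R\<^sub>3(n)\<close> is a quadratic polynomial
  in \<open>m\<close> on each residue class \<open>n = 3 m + a\<close>. These polynomials have integer coefficients, so shifting \<open>m\<close>
  by \<open>p\<close>, that is \<open>n\<close> by \<open>3 p\<close>, does not change their values modulo \<open>p\<close>.
\<close>

section \<open>The max-rook number as the largest staircase\<close>

lemma max_rook_ge_iff_placement:
  "k \<le> max_rook \<pi> \<longleftrightarrow> (\<exists>S \<in> rook_placements \<pi>. k \<le> card S)"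
  by (simp add: max_rook_def Max_ge_iff finite_rook_placements rook_placements_nonempty)

text \<open>
  The rooks on an antidiagonal of the staircase give one direction. Conversely, among \<open>k\<close> rooks at
  most \<open>i\<close> stand in the first \<open>i\<close> rows; the other \<open>k - i\<close> occupy distinct columns, all within the
  length of row \<open>i\<close>, because rows further down are no longer.
\<close>

lemma max_rook_ge_iff:
  assumes sorted: "sorted_wrt (\<ge>) \<pi>"
  shows "k \<le> max_rook \<pi> \<longleftrightarrow> (\<forall>i<k. i < length \<pi> \<and> k - i \<le> \<pi> ! i)"
proof
  assume "k \<le> max_rook \<pi>"
  then obtain S where S: "S \<in> rook_placements \<pi>" and cS: "k \<le> card S"
    using max_rook_ge_iff_placement by blast
  have inj: "inj_on fst S" "inj_on snd S"
    using S unfolding rook_placements_def non_intersecting_def inj_on_def by blast+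
  have sub: "S \<subseteq> ferrers_board \<pi>"
    using S by (simp add: rook_placements_def)
  have "ferrers_board \<pi> = (SIGMA i:{..<length \<pi>}. {..<\<pi> ! i})"
    by (auto simp: ferrers_board_def)
  then have fin: "finite S"
    using sub finite_subset by fastforce
  show "\<forall>i<k. i < length \<pi> \<and> k - i \<le> \<pi> ! i"
  proof (intro allI impI)
    fix i assume i: "i < k"
    let ?top = "{s \<in> S. fst s < i}" and ?low = "{s \<in> S. i \<le> fst s}"
    have "card ?top \<le> card {..<i}"
      by (rule card_inj_on_le[of fst]) (use inj in \<open>auto intro: inj_on_subset\<close>)
    moreover have "card S = card ?top + card ?low"
      by (subst card_Un_disjoint[symmetric]) (use fin in \<open>auto intro: arg_cong[where f=card]\<close>)
    ultimately have low: "k - i \<le> card ?low"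
      using cS by simp
    then have "?low \<noteq> {}"
      using i by (metis card.empty le_zero_eq less_irrefl zero_less_diff)
    then have len: "i < length \<pi>"
      using sub by (fastforce simp: ferrers_board_def)
    have "\<pi> ! r \<le> \<pi> ! i" if "i \<le> r" "r < length \<pi>" for r
      using sorted_wrt_nth_less[OF sorted, of i r] that by (cases "i = r") auto
    then have "snd ` ?low \<subseteq> {..<\<pi> ! i}"
      using sub by (fastforce simp: ferrers_board_def)
    then have "card ?low \<le> card {..<\<pi> ! i}"
      by (intro card_inj_on_le[of snd]) (use inj in \<open>auto intro: inj_on_subset\<close>)
    then show "i < length \<pi> \<and> k - i \<le> \<pi> ! i"
      using len low by simp
  qed
next
  assume stair: "\<forall>i<k. i < length \<pi> \<and> k - i \<le> \<pi> ! i"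
  \<comment> \<open>One rook in each of the first \<open>k\<close> rows, at the last square of its staircase row.\<close>
  let ?S = "(\<lambda>i. (i, k - Suc i)) ` {..<k}"
  have "?S \<in> rook_placements \<pi>"
    using stair by (force simp: rook_placements_def ferrers_board_def non_intersecting_def)
  moreover have "card ?S = k"
    by (subst card_image) (auto simp: inj_on_def)
  ultimately show "k \<le> max_rook \<pi>"
    using max_rook_ge_iff_placement by force
qed

lemma less_3_conv: "i < (3::nat) \<longleftrightarrow> i = 0 \<or> i = 1 \<or> i = 2"
  by auto

lemma less_4_conv: "i < (4::nat) \<longleftrightarrow> i = 0 \<or> i = 1 \<or> i = 2 \<or> i = 3"
  by auto

lemma max_rook_eq_3_iff:
  assumes "sorted_wrt (\<ge>) \<pi>" and "\<forall>x \<in> set \<pi>. 0 < x"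
  shows "max_rook \<pi> = 3 \<longleftrightarrow> (\<exists>x y z zs. \<pi> = x # y # z # zs \<and> 3 \<le> x \<and> 2 \<le> y
           \<and> (x = 3 \<or> y = 2 \<or> z = 1 \<or> zs = []))"
proof -
  have "max_rook \<pi> = 3 \<longleftrightarrow> 3 \<le> max_rook \<pi> \<and> \<not> 4 \<le> max_rook \<pi>"
    by auto
  also have "\<dots> \<longleftrightarrow> (\<exists>x y z zs. \<pi> = x # y # z # zs \<and> 3 \<le> x \<and> 2 \<le> y
           \<and> (x = 3 \<or> y = 2 \<or> z = 1 \<or> zs = []))"
  proof (cases "3 \<le> length \<pi>")
    case False
    then show ?thesis
      by (auto simp: max_rook_ge_iff[OF assms(1)] dest!: spec[of _ 2])
  next
    case True
    then obtain x y z zs where pi: "\<pi> = x # y # z # zs"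
      by (auto simp: numeral_3_eq_3 Suc_le_length_iff)
    have "zs \<noteq> [] \<Longrightarrow> 0 < hd zs"
      using assms(2) pi by simp
    then show ?thesis
      using assms unfolding max_rook_ge_iff[OF assms(1)] unfolding pi
      by (cases zs) (auto simp: less_3_conv less_4_conv all_conj_distrib imp_disjL)
  qed
  finally show ?thesis .
qed

section \<open>Partitions with small parts\<close>

lemma sorted_bounded_split:
  fixes xs :: "'a::linorder list"
  assumes "sorted_wrt (\<ge>) xs" and "\<forall>x \<in> set xs. x \<le> m"
  obtains a ys where "xs = replicate a m @ ys" "sorted_wrt (\<ge>) ys" "\<forall>y \<in> set ys. y < m"
proof -
  have "\<exists>a ys. xs = replicate a m @ ys \<and> sorted_wrt (\<ge>) ys \<and> (\<forall>y \<in> set ys. y < m)"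
    using assms
  proof (induction xs)
    case Nil
    then show ?case by simp
  next
    case (Cons x xs)
    show ?case
    proof (cases "x = m")
      case True
      obtain a ys where "xs = replicate a m @ ys" "sorted_wrt (\<ge>) ys" "\<forall>y \<in> set ys. y < m"
        using Cons by auto
      then show ?thesis
        using True by (intro exI[of _ "Suc a"] exI[of _ ys]) simp
    next
      case False
      then have "\<forall>y \<in> set (x # xs). y < m"
        using Cons.prems by auto
      then show ?thesis
        using Cons.prems(1) by (intro exI[of _ 0] exI[of _ "x # xs"]) simp
    qed
  qed
  then show thesis
    using that by blast
qed

lemma sorted_parts_le_1:
  fixes xs :: "nat list"
  assumes "\<forall>x \<in> set xs. 0 < x \<and> x \<le> 1"
  obtains c where "xs = replicate c 1"
proof -
  have "\<forall>x \<in> set xs. x = 1"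
    using assms by auto
  then show thesis
    using that by (metis replicate_length_same)
qed

lemma sorted_parts_le_2:
  fixes xs :: "nat list"
  assumes "sorted_wrt (\<ge>) xs" and "\<forall>x \<in> set xs. 0 < x \<and> x \<le> 2"
  obtains b c where "xs = replicate b 2 @ replicate c 1"
proof -
  have "\<forall>x \<in> set xs. x \<le> 2"
    using assms(2) by simp
  with assms(1) obtain b ys where b: "xs = replicate b 2 @ ys" "\<forall>y \<in> set ys. y < 2"
    by (rule sorted_bounded_split)
  have "set ys \<subseteq> set xs"
    unfolding b(1) by simp
  then have bounds: "0 < y" "y < 2" if "y \<in> set ys" for y
    using that assms(2) b(2) by blast+
  have "\<forall>y \<in> set ys. 0 < y \<and> y \<le> 1"
    using bounds by force
  then obtain c where "ys = replicate c 1"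
    by (rule sorted_parts_le_1)
  then show thesis
    using b(1) that[of b c] by simp
qed

lemma sorted_parts_le_3:
  fixes xs :: "nat list"
  assumes "sorted_wrt (\<ge>) xs" and "\<forall>x \<in> set xs. 0 < x \<and> x \<le> 3"
  obtains a b c where "xs = replicate a 3 @ replicate b 2 @ replicate c 1"
proof -
  have "\<forall>x \<in> set xs. x \<le> 3"
    using assms(2) by simp
  with assms(1) obtain a ys
    where a: "xs = replicate a 3 @ ys" "sorted_wrt (\<ge>) ys" "\<forall>y \<in> set ys. y < 3"
    by (rule sorted_bounded_split)
  have "set ys \<subseteq> set xs"
    unfolding a(1) by simp
  then have bounds: "0 < y" "y < 3" if "y \<in> set ys" for y
    using that assms(2) a(3) by blast+
  have "\<forall>y \<in> set ys. 0 < y \<and> y \<le> 2"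
    using bounds by force
  with a(2) obtain b c where "ys = replicate b 2 @ replicate c 1"
    by (rule sorted_parts_le_2)
  then show thesis
    using a(1) that[of a b c] by simp
qed

section \<open>Counting lattice points in a triangle\<close>

text \<open>The points with natural coordinates on or below the line \<open>p a + q b = N\<close>.\<close>

definition triangle :: "nat \<Rightarrow> nat \<Rightarrow> nat \<Rightarrow> (nat \<times> nat) set" where
  "triangle p q N = {(a, b). p * a + q * b \<le> N}"

lemma finite_triangle:
  assumes "0 < p" "0 < q"
  shows "finite (triangle p q N)"
proof (rule finite_subset)
  show "triangle p q N \<subseteq> {..N} \<times> {..N}"
  proof
    fix s assume "s \<in> triangle p q N"
    then obtain a b where s: "s = (a, b)" "p * a + q * b \<le> N"
      by (auto simp: triangle_def)
    have "a \<le> p * a" "b \<le> q * b"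
      using assms by auto
    then have "a \<le> N" "b \<le> N"
      using s(2) by linarith+
    then show "s \<in> {..N} \<times> {..N}"
      using s(1) by simp
  qed
qed auto

lemma card_triangle_base:
  assumes "0 < q" "N < p"
  shows "card (triangle p q N) = N div q + 1"
proof -
  have "a = 0" if "p * a + q * b \<le> N" for a b
    using that assms(2) by (cases a) auto
  then have "triangle p q N = Pair 0 ` {..N div q}"
    using assms(1) by (force simp: triangle_def less_eq_div_iff_mult_less_eq mult.commute)
  then show ?thesis
    by (simp add: card_image inj_on_def)
qed

text \<open>
  The points with \<open>a > 0\<close> form a translate of the smaller triangle, and those with \<open>a = 0\<close> are
  \<open>b = 0, \<dots>, (N + p) div q\<close>.
\<close>

lemma card_triangle_step:
  assumes "0 < p" "0 < q"
  shows "card (triangle p q (N + p)) = card (triangle p q N) + (N + p) div q + 1"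
proof -
  let ?f = "map_prod Suc id" and ?A = "Pair (0::nat) ` {..(N + p) div q}"
  have "triangle p q (N + p) = ?f ` triangle p q N \<union> ?A"
  proof (intro set_eqI)
    fix s :: "nat \<times> nat"
    obtain a b where s: "s = (a, b)" by (cases s)
    show "s \<in> triangle p q (N + p) \<longleftrightarrow> s \<in> ?f ` triangle p q N \<union> ?A"
      using assms(2) unfolding s
      by (cases a) (auto simp: triangle_def less_eq_div_iff_mult_less_eq mult.commute image_iff)
  qed
  moreover have "?f ` triangle p q N \<inter> ?A = {}"
    by auto
  moreover have "card (?f ` triangle p q N) = card (triangle p q N)"
    by (intro card_image) (auto simp: inj_on_def)
  moreover have "card ?A = (N + p) div q + 1"
    by (simp add: card_image inj_on_def)
  ultimately show ?thesis
    using finite_triangle[OF assms, of N] by (simp add: card_Un_disjoint)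
qed

lemma card_triangle_2_1_consecutive:
  "2 * (card (triangle 2 1 (N + 1)) + card (triangle 2 1 N)) = (N + 2) * (N + 3)"
proof (induction N)
  case 0
  then show ?case
    by (simp add: card_triangle_base)
next
  case (Suc N)
  then show ?case
    using card_triangle_step[of 2 1 N] by (simp add: algebra_simps)
qed

text \<open>
  The two new slices have \<open>(N + 6) div 2 + 1\<close> and \<open>(N + 3) div 2 + 1\<close> points. As \<open>N + 6\<close> and \<open>N + 3\<close>
  have opposite parity, the sum does not involve a case distinction.
\<close>

lemma card_triangle_3_2_step:
  "card (triangle 3 2 (N + 6)) + card (triangle 3 2 (N + 3))
   = card (triangle 3 2 (N + 3)) + card (triangle 3 2 N) + N + 6"
proof -
  have "(N + 6) div 2 + (N + 3) div 2 = N + 4"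
    by presburger
  then show ?thesis
    using card_triangle_step[of 3 2 N] card_triangle_step[of 3 2 "N + 3"]
    by (simp add: add.assoc)
qed

lemma card_triangle_3_2_pair:
  assumes "r < 3"
  shows "2 * (card (triangle 3 2 (3 * q + r + 3)) + card (triangle 3 2 (3 * q + r)))
    = 3 * q * q + 9 * q + 2 * r * q + (if r = 0 then 8 else if r = 1 then 10 else 14)"
proof (induction q)
  case 0
  have "r \<in> {0, 1, 2}"
    using assms by auto
  then show ?case
    using card_triangle_step[of 3 2 r] by (auto simp: card_triangle_base)
next
  case (Suc q)
  then show ?case
    using card_triangle_3_2_step[of "3 * q + r"] by (simp add: algebra_simps)
qed

section \<open>The four families of partitions with max-rook number three\<close>

text \<open>The set of partitions counted by \<open>R 3 n\<close>.\<close>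

definition rook3 :: "nat \<Rightarrow> nat list set" where
  "rook3 n = {\<pi> \<in> int_partitions n. max_rook \<pi> = 3}"

lemma rook3_iff:
  "\<pi> \<in> rook3 n \<longleftrightarrow> \<pi> \<in> int_partitions n \<and>
     (\<exists>x y z zs. \<pi> = x # y # z # zs \<and> 3 \<le> x \<and> 2 \<le> y \<and> (x = 3 \<or> y = 2 \<or> z = 1 \<or> zs = []))"
proof (cases "\<pi> \<in> int_partitions n")
  case True
  then show ?thesis
    using max_rook_eq_3_iff[of \<pi>] by (simp add: rook3_def int_partitions_def)
qed (simp add: rook3_def)

lemma finite_rook3: "finite (rook3 n)"
  by (simp add: rook3_def finite_int_partitions)

lemma count_list_replicate: "count_list (replicate k x) y = (if x = y then k else 0)"
  by (induction k) auto

lemma sorted_wrt_ge_replicate: "sorted_wrt (\<ge>) (replicate k (x::nat))"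
  by (induction k) auto

text \<open>
  The partitions \<open>3\<^sup>a\<^sup>+\<^sup>1 2\<^sup>b 1\<^sup>c\<close>. The excluded point \<open>(0, 0)\<close> is the one whose second part is less than \<open>2\<close>;
  a third part exists because \<open>n > 6\<close>.
\<close>

lemma card_rook3_first_eq_3:
  assumes "9 < n"
  shows "card {\<pi> \<in> rook3 n. \<pi> ! 0 = 3} + 1 = card (triangle 3 2 (n - 3))"
proof -
  let ?f = "\<lambda>(a, b). replicate (Suc a) 3 @ replicate b 2 @ replicate (n - 3 - 3 * a - 2 * b) (1::nat)"
  let ?D = "triangle 3 2 (n - 3) - {(0, 0)}"
  have inj: "inj_on ?f ?D"
  proof (rule inj_on_inverseI[where g = "\<lambda>\<pi>. (count_list \<pi> 3 - 1, count_list \<pi> 2)"])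
  qed (auto simp: count_list_replicate)
  have "?f ` ?D = {\<pi> \<in> rook3 n. \<pi> ! 0 = 3}"
  proof (intro equalityI subsetI)
    fix \<pi> assume "\<pi> \<in> ?f ` ?D"
    then obtain a b where "(a, b) \<in> ?D" and pi: "\<pi> = ?f (a, b)"
      by fast
    then have ab: "3 * a + 2 * b \<le> n - 3" "(a, b) \<noteq> (0, 0)"
      by (simp_all add: triangle_def)
    have part: "\<pi> \<in> int_partitions n"
      using ab assms unfolding pi
      by (auto simp: int_partitions_def sorted_wrt_append sorted_wrt_ge_replicate sum_list_replicate)
    let ?c = "n - 3 - 3 * a - 2 * b"
    have "\<exists>y z zs. \<pi> = 3 # y # z # zs \<and> 2 \<le> y"
    proof (cases a)
      case (Suc a')
      show ?thesis
      proof (cases a')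
        case 0
        show ?thesis
          using assms Suc 0 ab unfolding pi
          by (cases b; cases ?c) auto
      qed (use Suc pi in auto)
    next
      case 0
      then obtain b' where b': "b = Suc b'"
        using ab by (cases b) auto
      show ?thesis
        using assms 0 b' ab unfolding pi
        by (cases b'; cases ?c) auto
    qed
    then show "\<pi> \<in> {\<pi> \<in> rook3 n. \<pi> ! 0 = 3}"
      using part by (auto simp: rook3_iff)
  next
    fix \<pi> assume "\<pi> \<in> {\<pi> \<in> rook3 n. \<pi> ! 0 = 3}"
    then obtain y z zs where pi: "\<pi> = 3 # y # z # zs" "2 \<le> y" and part: "\<pi> \<in> int_partitions n"
      by (auto simp: rook3_iff)
    then have "sorted_wrt (\<ge>) (y # z # zs)" "\<forall>x \<in> set (y # z # zs). 0 < x \<and> x \<le> 3"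
      by (auto simp: int_partitions_def)
    then obtain a b c where abc: "y # z # zs = replicate a 3 @ replicate b 2 @ replicate c 1"
      by (rule sorted_parts_le_3)
    then have pi': "\<pi> = replicate (Suc a) 3 @ replicate b 2 @ replicate c 1"
      using pi by simp
    have c: "c + 2 * b + 3 * a + 3 = n"
      using part unfolding pi' by (simp add: int_partitions_def sum_list_replicate)
    have "(a, b) \<noteq> (0, 0)"
    proof
      assume "(a, b) = (0, 0)"
      then have "y # z # zs = replicate c 1"
        using abc by simp
      then show False
        using pi(2) by (simp add: Cons_replicate_eq)
    qed
    moreover have "\<pi> = ?f (a, b)"
      using pi' c by auto
    ultimately show "\<pi> \<in> ?f ` ?D"
      using c by (intro image_eqI[of _ _ "(a, b)"]) (auto simp: triangle_def)
  qed
  then have "card {\<pi> \<in> rook3 n. \<pi> ! 0 = 3} = card ?D"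
    using card_image[OF inj] by simp
  moreover have "card ?D + 1 = card (triangle 3 2 (n - 3))"
    using card_Suc_Diff1[OF finite_triangle, of 3 2 "(0, 0)" "n - 3"] by (simp add: triangle_def)
  ultimately show ?thesis by simp
qed

text \<open>
  The partitions with first part \<open>s + 4\<close> followed by \<open>b + 1\<close> parts \<open>2\<close> and by parts \<open>1\<close>. The
  excluded point \<open>(0, n - 6)\<close> is the partition \<open>(n - 2, 2)\<close>, which has no third part.
\<close>

lemma card_rook3_second_eq_2:
  assumes "9 < n"
  shows "card {\<pi> \<in> rook3 n. 3 < \<pi> ! 0 \<and> \<pi> ! 1 = 2} + 1 = card (triangle 2 1 (n - 6))"
proof -
  let ?f = "\<lambda>(b, s). (s + 4) # replicate (Suc b) 2 @ replicate (n - 6 - 2 * b - s) (1::nat)"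
  let ?D = "triangle 2 1 (n - 6) - {(0, n - 6)}"
  have inj: "inj_on ?f ?D"
  proof (rule inj_on_inverseI[where g = "\<lambda>\<pi>. (count_list \<pi> 2 - 1, hd \<pi> - 4)"])
  qed (auto simp: count_list_replicate)
  have "?f ` ?D = {\<pi> \<in> rook3 n. 3 < \<pi> ! 0 \<and> \<pi> ! 1 = 2}"
  proof (intro equalityI subsetI)
    fix \<pi> assume "\<pi> \<in> ?f ` ?D"
    then obtain b s where "(b, s) \<in> ?D" and pi: "\<pi> = ?f (b, s)"
      by fast
    then have bs: "2 * b + s \<le> n - 6" "(b, s) \<noteq> (0, n - 6)"
      by (simp_all add: triangle_def)
    have part: "\<pi> \<in> int_partitions n"
      using bs assms unfolding pi
      by (auto simp: int_partitions_def sorted_wrt_append sorted_wrt_ge_replicate sum_list_replicate)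
    have "\<exists>z zs. \<pi> = (s + 4) # 2 # z # zs"
      using bs unfolding pi by (cases b; cases "n - 6 - 2 * b - s") auto
    then show "\<pi> \<in> {\<pi> \<in> rook3 n. 3 < \<pi> ! 0 \<and> \<pi> ! 1 = 2}"
      using part by (auto simp: rook3_iff)
  next
    fix \<pi> assume "\<pi> \<in> {\<pi> \<in> rook3 n. 3 < \<pi> ! 0 \<and> \<pi> ! 1 = 2}"
    then obtain x z zs where pi: "\<pi> = x # 2 # z # zs" "3 < x" and part: "\<pi> \<in> int_partitions n"
      by (auto simp: rook3_iff)
    then have "sorted_wrt (\<ge>) (z # zs)" "\<forall>x \<in> set (z # zs). 0 < x \<and> x \<le> 2"
      by (auto simp: int_partitions_def)
    then obtain b c where bc: "z # zs = replicate b 2 @ replicate c 1"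
      by (rule sorted_parts_le_2)
    obtain s where s: "x = s + 4"
      using pi(2) by (intro that[of "x - 4"]) simp
    have pi': "\<pi> = (s + 4) # replicate (Suc b) 2 @ replicate c 1"
      using pi s bc by simp
    have c: "c + 2 * b + s + 6 = n"
      using part unfolding pi' by (simp add: int_partitions_def sum_list_replicate)
    have "(b, s) \<noteq> (0, n - 6)"
      using bc c by auto
    moreover have "\<pi> = ?f (b, s)"
      using pi' c by auto
    ultimately show "\<pi> \<in> ?f ` ?D"
      using c by (intro image_eqI[of _ _ "(b, s)"]) (auto simp: triangle_def)
  qed
  then have "card {\<pi> \<in> rook3 n. 3 < \<pi> ! 0 \<and> \<pi> ! 1 = 2} = card ?D"
    using card_image[OF inj] by simp
  moreover have "card ?D + 1 = card (triangle 2 1 (n - 6))"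
    using card_Suc_Diff1[OF finite_triangle, of 2 1 "(0, n - 6)" "n - 6"] by (simp add: triangle_def)
  ultimately show ?thesis by simp
qed

text \<open>
  The partitions with first two parts \<open>b + s + 3\<close> and \<open>b + 3\<close> followed by at least one part \<open>1\<close>. The
  excluded point \<open>(0, 0)\<close> has first part \<open>3\<close>, so it belongs to the first family.
\<close>

lemma card_rook3_third_eq_1:
  assumes "9 < n"
  shows "card {\<pi> \<in> rook3 n. 3 < \<pi> ! 0 \<and> 2 < \<pi> ! 1 \<and> \<pi> ! 2 = 1} + 1 = card (triangle 2 1 (n - 7))"
proof -
  let ?f = "\<lambda>(b, s). (b + s + 3) # (b + 3) # replicate (n - 6 - 2 * b - s) (1::nat)"
  let ?D = "triangle 2 1 (n - 7) - {(0, 0)}"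
  have inj: "inj_on ?f ?D"
    by (auto simp: inj_on_def)
  have "?f ` ?D = {\<pi> \<in> rook3 n. 3 < \<pi> ! 0 \<and> 2 < \<pi> ! 1 \<and> \<pi> ! 2 = 1}"
  proof (intro equalityI subsetI)
    fix \<pi> assume "\<pi> \<in> ?f ` ?D"
    then obtain b s where "(b, s) \<in> ?D" and pi: "\<pi> = ?f (b, s)"
      by fast
    then have bs: "2 * b + s \<le> n - 7" "(b, s) \<noteq> (0, 0)"
      by (simp_all add: triangle_def)
    have part: "\<pi> \<in> int_partitions n"
      using bs assms unfolding pi
      by (auto simp: int_partitions_def sorted_wrt_ge_replicate sum_list_replicate)
    have "\<exists>zs. \<pi> = (b + s + 3) # (b + 3) # 1 # zs"
      using bs assms unfolding pi by (cases "n - 6 - 2 * b - s") auto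
    then show "\<pi> \<in> {\<pi> \<in> rook3 n. 3 < \<pi> ! 0 \<and> 2 < \<pi> ! 1 \<and> \<pi> ! 2 = 1}"
      using part bs(2) by (auto simp: rook3_iff)
  next
    fix \<pi> assume "\<pi> \<in> {\<pi> \<in> rook3 n. 3 < \<pi> ! 0 \<and> 2 < \<pi> ! 1 \<and> \<pi> ! 2 = 1}"
    then obtain x y zs where pi: "\<pi> = x # y # 1 # zs" "3 < x" "2 < y" and part: "\<pi> \<in> int_partitions n"
      by (auto simp: rook3_iff)
    then have "y \<le> x" "\<forall>x \<in> set zs. 0 < x \<and> x \<le> 1"
      by (auto simp: int_partitions_def)
    then obtain c where zs: "zs = replicate c 1"
      by (metis sorted_parts_le_1)
    define b s where "b = y - 3" and "s = x - y"
    have xy: "y = b + 3" "x = b + s + 3"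
      using pi \<open>y \<le> x\<close> by (auto simp: b_def s_def)
    have c: "c + 2 * b + s + 7 = n"
      using part unfolding pi(1) xy zs by (simp add: int_partitions_def sum_list_replicate)
    then have "n - 6 - 2 * b - s = Suc c"
      by simp
    then have "\<pi> = ?f (b, s)"
      using pi(1) xy zs by simp
    moreover have "(b, s) \<noteq> (0, 0)"
      using pi(2) xy by auto
    ultimately show "\<pi> \<in> ?f ` ?D"
      using c by (intro image_eqI[of _ _ "(b, s)"]) (auto simp: triangle_def)
  qed
  then have "card {\<pi> \<in> rook3 n. 3 < \<pi> ! 0 \<and> 2 < \<pi> ! 1 \<and> \<pi> ! 2 = 1} = card ?D"
    using card_image[OF inj] by simp
  moreover have "card ?D + 1 = card (triangle 2 1 (n - 7))"
    using card_Suc_Diff1[OF finite_triangle, of 2 1 "(0, 0)" "n - 7"] by (simp add: triangle_def)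
  ultimately show ?thesis by simp
qed

text \<open>
  Since the three inequalities rule out the other alternatives, these partitions have exactly three
  parts; \<open>a\<close> is the excess of the smallest part over \<open>2\<close>, and \<open>b\<close> the difference between the two
  smaller parts. The excluded point \<open>(0, 0)\<close> has second part \<open>2\<close>. Here \<open>n > 9\<close> is needed in full: for
  \<open>n = 9\<close> the point \<open>(1, 0)\<close> gives \<open>(3, 3, 3)\<close>, whose first part is not greater than \<open>3\<close>.
\<close>

lemma card_rook3_three_parts:
  assumes "9 < n"
  shows "card {\<pi> \<in> rook3 n. 3 < \<pi> ! 0 \<and> 2 < \<pi> ! 1 \<and> 1 < \<pi> ! 2} + 1 = card (triangle 3 2 (n - 6))"
proof -
  let ?f = "\<lambda>(a, b). [n - 4 - 2 * a - b, a + b + 2, a + (2::nat)]"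
  let ?D = "triangle 3 2 (n - 6) - {(0, 0)}"
  have inj: "inj_on ?f ?D"
    by (auto simp: inj_on_def)
  have "?f ` ?D = {\<pi> \<in> rook3 n. 3 < \<pi> ! 0 \<and> 2 < \<pi> ! 1 \<and> 1 < \<pi> ! 2}"
  proof (intro equalityI subsetI)
    fix \<pi> assume "\<pi> \<in> ?f ` ?D"
    then obtain a b where "(a, b) \<in> ?D" and pi: "\<pi> = ?f (a, b)"
      by fast
    then have ab: "3 * a + 2 * b \<le> n - 6" "(a, b) \<noteq> (0, 0)"
      by (simp_all add: triangle_def)
    show "\<pi> \<in> {\<pi> \<in> rook3 n. 3 < \<pi> ! 0 \<and> 2 < \<pi> ! 1 \<and> 1 < \<pi> ! 2}"
      using assms ab unfolding pi by (auto simp: rook3_iff int_partitions_def)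
  next
    fix \<pi> assume "\<pi> \<in> {\<pi> \<in> rook3 n. 3 < \<pi> ! 0 \<and> 2 < \<pi> ! 1 \<and> 1 < \<pi> ! 2}"
    then obtain x y z where pi: "\<pi> = [x, y, z]" "3 < x" "2 < y" "1 < z" and part: "\<pi> \<in> int_partitions n"
      by (auto simp: rook3_iff)
    then have ord: "z \<le> y" "y \<le> x" "x + y + z = n"
      by (auto simp: int_partitions_def)
    define a b where "a = z - 2" and "b = y - z"
    have "\<pi> = ?f (a, b)" "(a, b) \<noteq> (0, 0)" "3 * a + 2 * b \<le> n - 6"
      using pi ord by (auto simp: a_def b_def)
    then show "\<pi> \<in> ?f ` ?D"
      by (intro image_eqI[of _ _ "(a, b)"]) (auto simp: triangle_def)
  qed
  then have "card {\<pi> \<in> rook3 n. 3 < \<pi> ! 0 \<and> 2 < \<pi> ! 1 \<and> 1 < \<pi> ! 2} = card ?D"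
    using card_image[OF inj] by simp
  moreover have "card ?D + 1 = card (triangle 3 2 (n - 6))"
    using card_Suc_Diff1[OF finite_triangle, of 3 2 "(0, 0)" "n - 6"] by (simp add: triangle_def)
  ultimately show ?thesis by simp
qed

lemma R_3_eq_card_triangles:
  assumes "9 < n"
  shows "R 3 n + 4 = card (triangle 3 2 (n - 3)) + card (triangle 3 2 (n - 6))
           + card (triangle 2 1 (n - 6)) + card (triangle 2 1 (n - 7))"
proof -
  let ?A = "{\<pi> \<in> rook3 n. \<pi> ! 0 = 3}"
  let ?B = "{\<pi> \<in> rook3 n. 3 < \<pi> ! 0 \<and> \<pi> ! 1 = 2}"
  let ?C = "{\<pi> \<in> rook3 n. 3 < \<pi> ! 0 \<and> 2 < \<pi> ! 1 \<and> \<pi> ! 2 = 1}"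
  let ?D = "{\<pi> \<in> rook3 n. 3 < \<pi> ! 0 \<and> 2 < \<pi> ! 1 \<and> 1 < \<pi> ! 2}"
  have "(\<pi> ! 0 = 3 \<or> 3 < \<pi> ! 0) \<and> (\<pi> ! 1 = 2 \<or> 2 < \<pi> ! 1) \<and> (\<pi> ! 2 = 1 \<or> 1 < \<pi> ! 2)"
    if "\<pi> \<in> rook3 n" for \<pi>
    using that by (auto simp: rook3_iff int_partitions_def)
  then have split: "rook3 n = ?A \<union> (?B \<union> (?C \<union> ?D))"
    by blast
  have "R 3 n = card (rook3 n)"
    by (simp add: R_def rook3_def)
  also have "\<dots> = card ?A + (card ?B + (card ?C + card ?D))"
    by (subst split, (subst card_Un_disjoint; (auto simp: finite_rook3)?)+)
  finally show ?thesis
    using card_rook3_first_eq_3[OF assms] card_rook3_second_eq_2[OF assms]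
      card_rook3_third_eq_1[OF assms] card_rook3_three_parts[OF assms] by simp
qed

section \<open>The closed formula and its periodicity\<close>

lemma R_3_closed_form:
  assumes "9 < n" and "0 \<le> a" "a \<le> 2" and "int n = 3 * m + a"
  shows "int (R 3 n) = (if a = 0 then 6 * m^2 - 15 * m + 7
                        else if a = 1 then 6 * m^2 - 11 * m + 2
                        else 6 * m^2 - 7 * m - 1)"
proof -
  \<comment> \<open>As \<open>n - 6 \<ge> 4\<close>, the number \<open>m - 2\<close> is the quotient of \<open>n - 6\<close> by \<open>3\<close>.\<close>
  define r q where "r = nat a" and "q = nat (m - 2)"
  have a: "a = int r" and m: "m = int q + 2" and r: "r < 3"
    using assms by (auto simp: r_def q_def)
  have n: "n = 3 * q + r + 6"
    using assms(4) a m by simp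
  have N: "n - 7 = 3 * q + r - 1" "n - 6 = 3 * q + r" "n - 3 = 3 * q + r + 3" "1 \<le> 3 * q + r"
    using n assms(1) by auto
  have "2 * (card (triangle 2 1 (3 * q + r)) + card (triangle 2 1 (3 * q + r - 1)))
      = (3 * q + r + 1) * (3 * q + r + 2)"
  proof -
    obtain N where "3 * q + r = N + 1"
      using N(4) by (metis add.commute le_Suc_ex)
    then show ?thesis
      using card_triangle_2_1_consecutive[of N] by (simp add: algebra_simps)
  qed
  then have "int (2 * (card (triangle 2 1 (3 * q + r)) + card (triangle 2 1 (3 * q + r - 1))))
      = (3 * int q + int r + 1) * (3 * int q + int r + 2)"
    by (metis (mono_tags) of_nat_1 of_nat_add of_nat_mult of_nat_numeral)
  moreover have "int (2 * (card (triangle 3 2 (3 * q + r + 3)) + card (triangle 3 2 (3 * q + r))))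
      = 3 * int q * int q + 9 * int q + 2 * int r * int q
        + (if r = 0 then 8 else if r = 1 then 10 else 14)"
    unfolding card_triangle_3_2_pair[OF r] by simp
  moreover have "int (R 3 n) + 4 = int (card (triangle 3 2 (3 * q + r + 3)))
      + int (card (triangle 3 2 (3 * q + r))) + int (card (triangle 2 1 (3 * q + r)))
      + int (card (triangle 2 1 (3 * q + r - 1)))"
    using arg_cong[OF R_3_eq_card_triangles[OF assms(1)], of int] N by simp
  ultimately have double: "2 * int (R 3 n) + 8
      = 3 * int q * int q + 9 * int q + 2 * int r * int q
        + (if r = 0 then 8 else if r = 1 then 10 else 14)
        + (3 * int q + int r + 1) * (3 * int q + int r + 2)"
    by simp
  have "r = 0 \<or> r = 1 \<or> r = 2"
    using r by auto
  then show ?thesis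
    using double unfolding a m
    by (elim disjE) (simp_all add: power2_eq_square algebra_simps)
qed

lemma R_3_periodic:
  assumes "9 < n"
  shows "[R 3 (n + 3 * p) = R 3 n] (mod p)"
proof -
  define m a where "m = int (n div 3)" and "a = int (n mod 3)"
  have a: "0 \<le> a" "a \<le> 2" and n: "int n = 3 * m + a"
    unfolding m_def a_def by presburger+
  then have n': "int (n + 3 * p) = 3 * (m + int p) + a"
    by simp
  have "[m + int p = m] (mod int p)"
    by (simp add: cong_def)
  then have "[c * (m + int p)^2 - d * (m + int p) + e = c * m^2 - d * m + e] (mod int p)" for c d e
    by (intro cong_add cong_diff cong_mult cong_pow cong_refl)
  from this[of 6 15 7] this[of 6 11 2] this[of 6 7 "-1"]
  have "[int (R 3 (n + 3 * p)) = int (R 3 n)] (mod int p)"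
    using R_3_closed_form[OF assms a n] R_3_closed_form[OF _ a n'] assms by auto
  then show ?thesis
    by (simp add: cong_int_iff)
qed

theorem theorem4p1:
  shows "(\<forall>(n::nat) (m::int) (a::int). n > 9 \<longrightarrow> 0 \<le> a \<longrightarrow> a \<le> 2 \<longrightarrow> int n = 3 * m + a \<longrightarrow>
            int (R 3 n) = (if a = 0 then 6 * m^2 - 15 * m + 7
                           else if a = 1 then 6 * m^2 - 11 * m + 2
                           else 6 * m^2 - 7 * m - 1)) \<and>
         (\<forall>p::nat. p \<ge> 2 \<longrightarrow> (\<forall>n::nat. n > 9 \<longrightarrow> [R 3 (n + 3 * p) = R 3 n] (mod p)))"
  using R_3_closed_form R_3_periodic by blast

end
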